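(* Let $\mu=\mu_{x_0}$ be a probability measure on $\mathbb R$ that is not a Dirac mass and satisfies $\int_1^\infty\log x\,d\mu(x)<\infty$, and let $t>0$. Define $v_t=v_{x_0,t}$, $\Gamma_t$, $\Lambda_t=\Lambda_{x_0,t}$, $H_{-t}=H_{x_0,-t}$ as in the context. Then: (1) $H_{-t}$ is continuous and injective on $\overline{\Gamma}_t$. (2) Define $f_t:\mathbb R\to\mathbb R$ by $f_t(u_0)=\mathrm{Re}[H_{-t}(u_0+iv_t(u_0))]$. At every $u_0$ with $v_t(u_0)>0$, $f_t$ is differentiable and $0<f_t'(u_0)<2$. (3) $f_t$ is continuous, strictly increasing, and maps $\mathbb R$ onto $\mathbb R$; in particular $f_t^{-1}$ exists. (4) With $\varphi_t(u)=2v_t(f_t^{-1}(u))$ for $u\in\mathbb R$, we have $\varphi_t(u)\to0$ as $|u|\to\infty$, and $H_{-t}$ maps the graph of $v_t$ onto the graph of $\varphi_t$. (5) $H_{-t}$ maps the region above the graph of $v_t$ onto the region above the graph of $\varphi_t$. (6) The set $\Omega_{x_0,t}=\big[H_{-t}(\Lambda_t^c)\big]^c$ equals $\{u+iv\in\mathbb C:|v|<\varphi_t(u)\}$.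
   Context: $G_\mu(z)=\int\frac{d\mu(x)}{z-x}$ is the Cauchy transform. For $u\in\mathbb R$, $v_{x_0,t}(u)=\inf\{v>0:\int\frac{d\mu(x)}{(u-x)^2+v^2}\le\frac1t\}$ (so it is the unique $v>0$ with $\int\frac{d\mu(x)}{(u-x)^2+v^2}=\frac1t$ if such exists, and $0$ otherwise). $\Gamma_t=\{u+iv:v>v_{x_0,t}(u)\}$, $\Lambda_{x_0,t}=\{u+iv:|v|<v_{x_0,t}(u)\}$ (the support of $\mu$ is contained in $\overline{\Lambda}_{x_0,t}$). $H_{x_0,-t}(z)=z-tG_\mu(z)$ for $z\notin\mathrm{supp}\,\mu$, extended by continuity where needed (e.g. to points $u+iv_{x_0,t}(u)$ on the real line). *)

theory Defs
  imports "HOL-Probability.Probability"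
begin

definition cauchy_transform :: "real measure \<Rightarrow> complex \<Rightarrow> complex" where
  "cauchy_transform \<mu> z = (\<integral>x. 1 / (z - complex_of_real x) \<partial>\<mu>)"

definition v_t :: "real measure \<Rightarrow> real \<Rightarrow> real \<Rightarrow> real" where
  "v_t \<mu> t u = Inf {v. v > 0 \<and> (\<integral>x. 1 / ((u - x)\<^sup>2 + v\<^sup>2) \<partial>\<mu>) \<le> 1 / t}"

definition Gamma_t :: "real measure \<Rightarrow> real \<Rightarrow> complex set" where
  "Gamma_t \<mu> t = {z. Im z > v_t \<mu> t (Re z)}"

definition Lambda_t :: "real measure \<Rightarrow> real \<Rightarrow> complex set" where
  "Lambda_t \<mu> t = {z. \<bar>Im z\<bar> < v_t \<mu> t (Re z)}"

definition H_mt :: "real measure \<Rightarrow> real \<Rightarrow> complex \<Rightarrow> complex" where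
  "H_mt \<mu> t z = z - complex_of_real t * cauchy_transform \<mu> z"

definition f_t :: "real measure \<Rightarrow> real \<Rightarrow> real \<Rightarrow> real" where
  "f_t \<mu> t u0 = Re (H_mt \<mu> t (Complex u0 (v_t \<mu> t u0)))"

definition phi_t :: "real measure \<Rightarrow> real \<Rightarrow> real \<Rightarrow> real" where
  "phi_t \<mu> t u = 2 * v_t \<mu> t (inv (f_t \<mu> t) u)"

definition Omega_t :: "real measure \<Rightarrow> real \<Rightarrow> complex set" where
  "Omega_t \<mu> t = - (H_mt \<mu> t ` (- Lambda_t \<mu> t))"

end

theory Submission
  imports Defs
begin

text \<open>
  Let \<open>D\<close> be the set of \<open>z\<close> with \<open>\<integral> 1 / \<bar>z - x\<bar>\<^sup>2 d\<mu> \<le> 1 / t\<close>, the complement of \<open>\<Lambda>\<^sub>t\<close>. With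
  \<open>Q(z, w) = \<integral> 1 / ((z - x) (w - x)) d\<mu>\<close> one has
  \<open>H(z) - H(w) = (z - w) (1 + t Q(z, w))\<close>, and on \<open>D\<close> the Cauchy--Schwarz inequality gives
  \<open>\<bar>t Q\<bar> \<le> 1\<close>. In the closed upper half of \<open>D\<close> the inequality is strict unless \<open>z = w\<close> is real, since
  equality would make \<open>\<mu>\<close> a point mass; so \<open>H\<close> is Lipschitz and injective there.

  On the graph of \<open>v\<^sub>t\<close> the imaginary part of \<open>H\<close> is \<open>2 v\<^sub>t\<close>. Hence, with \<open>c = t Q\<close> at two graph
  points, the difference quotient of \<open>f\<^sub>t\<close> is exactly \<open>(1 - \<bar>c\<bar>\<^sup>2) / (1 - Re c)\<close>. It is positive, and
  it passes to the limit where \<open>v\<^sub>t > 0\<close>.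

  Finally \<open>H(z) - z\<close> is bounded on \<open>D\<close>, so \<open>H\<close> is proper there. The image of \<open>\<Gamma>\<^sub>t\<close> is open by
  invariance of domain and relatively closed off the graph of \<open>\<phi>\<^sub>t\<close>; by connectedness it
  fills the region above that graph.
\<close>

section \<open>Reciprocals in the extended reals and regions bounded by a graph\<close>

lemma inverse_ennreal_antimono:
  assumes "0 \<le> a" "a \<le> b"
  shows "inverse (ennreal b) \<le> inverse (ennreal a)"
proof (cases "a = 0")
  case False
  then show ?thesis
    using assms by (simp add: inverse_ennreal le_imp_inverse_le ennreal_leI)
qed simp

text \<open>The vertical shear by \<open>h\<close> is continuous and carries an open half-plane,
  which is convex, onto the region on the same side of the graph.\<close>

lemma connected_above_below_graph:
  fixes h :: "real \<Rightarrow> real"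
  assumes h: "continuous_on UNIV h"
  shows "connected {z. Im z > h (Re z)}" "connected {z. Im z < h (Re z)}"
proof -
  let ?s = "\<lambda>z. Complex (Re z) (Im z + h (Re z))"
  have cont: "continuous_on A ?s" for A
    by (intro continuous_on_Complex continuous_intros continuous_on_compose2[OF h]) auto
  have inv: "?s (Complex (Re z) (Im z - h (Re z))) = z" for z
    by simp
  have "{z. Im z > h (Re z)} = ?s ` {z. Im z > 0}"
  proof (intro set_eqI iffI)
    fix z assume "z \<in> {z. Im z > h (Re z)}"
    then show "z \<in> ?s ` {z. Im z > 0}"
      by (intro image_eqI[where f = ?s, OF inv[of z, symmetric]]) simp
  qed auto
  then show "connected {z. Im z > h (Re z)}"
    using connected_continuous_image[OF cont convex_connected[OF convex_halfspace_Im_gt[of 0]]] by simp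
  have "{z. Im z < h (Re z)} = ?s ` {z. Im z < 0}"
  proof (intro set_eqI iffI)
    fix z assume "z \<in> {z. Im z < h (Re z)}"
    then show "z \<in> ?s ` {z. Im z < 0}"
      by (intro image_eqI[where f = ?s, OF inv[of z, symmetric]]) simp
  qed auto
  then show "connected {z. Im z < h (Re z)}"
    using connected_continuous_image[OF cont convex_connected[OF convex_halfspace_Im_lt[of 0]]] by simp
qed

section \<open>The measure, its energy and the sublevel set of the energy\<close>

locale nondegenerate_measure = prob_space \<mu> for \<mu> :: "real measure" +
  fixes t :: real
  assumes sets_borel [measurable_cong]: "sets \<mu> = sets borel"
    and not_dirac: "\<mu> \<noteq> return borel a"
    and t_pos: "t > 0"
begin

text \<open>The reciprocal is taken in the extended nonnegative reals, so that a real \<open>z\<close> with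
  \<open>\<mu> {z} > 0\<close> has infinite energy; the real-valued integrand would vanish at \<open>x = z\<close>.\<close>

definition energy :: "complex \<Rightarrow> ennreal" where
  "energy z = (\<integral>\<^sup>+x. inverse (ennreal ((cmod (z - of_real x))\<^sup>2)) \<partial>\<mu>)"

text \<open>This is the complement of \<open>Lambda_t\<close>. Defining it by the energy treats real
  and nonreal points alike and lets Fatou's lemma show that it is closed.\<close>

definition D :: "complex set" where
  "D = {z. energy z \<le> ennreal (1 / t)}"

text \<open>Neither factor is conjugated: partial fractions then turn differences of the Cauchy
  transform into multiples of \<open>Q\<close>.\<close>

definition Q :: "complex \<Rightarrow> complex \<Rightarrow> complex" where
  "Q z w = (\<integral>x. 1 / ((z - of_real x) * (w - of_real x)) \<partial>\<mu>)"

text \<open>Fatou's lemma applies because the extended reciprocal is continuous everywhere,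
  including at zero, so the integrands converge for every \<open>x\<close>.\<close>

lemma energy_le_liminf:
  assumes "X \<longlonglongrightarrow> z"
  shows "energy z \<le> liminf (\<lambda>n. energy (X n))"
proof -
  have lim: "(\<lambda>n. inverse (ennreal ((cmod (X n - of_real x))\<^sup>2)))
      \<longlonglongrightarrow> inverse (ennreal ((cmod (z - of_real x))\<^sup>2))" for x
    by (rule continuous_on_tendsto_compose[OF continuous_on_inverse_ennreal[OF continuous_on_id, of UNIV]])
       (auto intro!: tendsto_intros assms)
  have "energy z = (\<integral>\<^sup>+x. liminf (\<lambda>n. inverse (ennreal ((cmod (X n - of_real x))\<^sup>2))) \<partial>\<mu>)"
    unfolding energy_def
    by (intro nn_integral_cong lim_imp_Liminf[symmetric] lim) auto
  also have "\<dots> \<le> liminf (\<lambda>n. energy (X n))"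
    unfolding energy_def by (intro nn_integral_liminf) measurable
  finally show ?thesis .
qed

lemma closed_D: "closed D"
  unfolding closed_sequential_limits
proof (intro allI impI, elim conjE)
  fix X z assume X: "\<forall>n. X n \<in> D" and lim: "X \<longlonglongrightarrow> z"
  have "energy z \<le> liminf (\<lambda>n. energy (X n))"
    by (rule energy_le_liminf[OF lim])
  also have "\<dots> \<le> liminf (\<lambda>n. ennreal (1 / t))"
    using X by (intro Liminf_mono) (auto simp: D_def)
  also have "\<dots> = ennreal (1 / t)"
    by (simp add: Liminf_const)
  finally show "z \<in> D"
    by (simp add: D_def)
qed

lemma energy_antimono:
  assumes "\<bar>v\<bar> \<le> \<bar>v'\<bar>"
  shows "energy (Complex u v') \<le> energy (Complex u v)"
  unfolding energy_def
proof (intro nn_integral_mono)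
  fix x :: real
  have "v\<^sup>2 \<le> v'\<^sup>2"
    using assms abs_le_square_iff by blast
  then have "(cmod (Complex u v - of_real x))\<^sup>2 \<le> (cmod (Complex u v' - of_real x))\<^sup>2"
    by (simp add: cmod_power2)
  then show "inverse (ennreal ((cmod (Complex u v' - of_real x))\<^sup>2))
      \<le> inverse (ennreal ((cmod (Complex u v - of_real x))\<^sup>2))"
    by (rule inverse_ennreal_antimono[rotated]) simp
qed

lemma cmod_ge_Im: "\<bar>Im z\<bar> \<le> cmod (z - of_real x)"
  using abs_Im_le_cmod[of "z - of_real x"] by simp

section \<open>The height function and its relation to the sublevel set\<close>

lemma integrable_kernel:
  assumes "v \<noteq> 0"
  shows "integrable \<mu> (\<lambda>x. 1 / ((u - x)\<^sup>2 + v\<^sup>2))"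
proof (rule integrable_const_bound[where B = "1 / v\<^sup>2"])
  show "AE x in \<mu>. norm (1 / ((u - x)\<^sup>2 + v\<^sup>2)) \<le> 1 / v\<^sup>2"
    using assms by (intro AE_I2) (auto intro!: divide_left_mono mult_pos_pos add_nonneg_pos)
qed measurable

lemma energy_eq_integral:
  assumes "v \<noteq> 0"
  shows "energy (Complex u v) = ennreal (\<integral>x. 1 / ((u - x)\<^sup>2 + v\<^sup>2) \<partial>\<mu>)"
proof -
  have "energy (Complex u v) = (\<integral>\<^sup>+x. ennreal (1 / ((u - x)\<^sup>2 + v\<^sup>2)) \<partial>\<mu>)"
    unfolding energy_def using assms
    by (intro nn_integral_cong, subst inverse_ennreal)
       (auto simp: cmod_power2 add_nonneg_pos divide_inverse)
  also have "\<dots> = ennreal (\<integral>x. 1 / ((u - x)\<^sup>2 + v\<^sup>2) \<partial>\<mu>)"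
    by (intro nn_integral_eq_integral integrable_kernel assms) auto
  finally show ?thesis .
qed

lemma mem_D_iff_kernel:
  assumes "v \<noteq> 0"
  shows "Complex u v \<in> D \<longleftrightarrow> (\<integral>x. 1 / ((u - x)\<^sup>2 + v\<^sup>2) \<partial>\<mu>) \<le> 1 / t"
  using t_pos by (simp add: D_def energy_eq_integral[OF assms] ennreal_le_iff)

lemma v_t_eq: "v_t \<mu> t u = Inf {v. v > 0 \<and> Complex u v \<in> D}"
  unfolding v_t_def by (rule arg_cong[where f = Inf]) (auto simp: mem_D_iff_kernel)

text \<open>At this height the kernel is at most \<open>1 / t\<close> pointwise. This makes the set
  in the infimum nonempty and bounds \<open>v_t\<close> by \<open>sqrt t\<close> uniformly in
  \<open>u\<close>.\<close>

lemma sqrt_t_mem_D: "Complex u (sqrt t) \<in> D"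
proof -
  have "(\<integral>x. 1 / ((u - x)\<^sup>2 + (sqrt t)\<^sup>2) \<partial>\<mu>) \<le> (\<integral>x. 1 / t \<partial>\<mu>)"
    using t_pos integrable_kernel[of "sqrt t" u]
    by (intro integral_mono) (auto intro!: divide_left_mono mult_pos_pos add_nonneg_pos)
  then show ?thesis
    using t_pos by (simp add: mem_D_iff_kernel prob_space)
qed

lemma v_t_nonneg: "0 \<le> v_t \<mu> t u"
  unfolding v_t_eq using sqrt_t_mem_D t_pos
  by (intro cInf_greatest) (auto intro!: exI[of _ "sqrt t"])

lemma v_t_le: "0 < v \<Longrightarrow> Complex u v \<in> D \<Longrightarrow> v_t \<mu> t u \<le> v"
  unfolding v_t_eq by (intro cInf_lower bdd_belowI[of _ 0]) auto

lemma mem_D_mono: "\<bar>v\<bar> \<le> \<bar>v'\<bar> \<Longrightarrow> Complex u v \<in> D \<Longrightarrow> Complex u v' \<in> D"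
  using energy_antimono[of v v' u] by (auto simp: D_def)

lemma mem_D_above:
  assumes "v_t \<mu> t u < v"
  shows "Complex u v \<in> D"
proof -
  have "{v. v > 0 \<and> Complex u v \<in> D} \<noteq> {}"
    using sqrt_t_mem_D t_pos by (auto intro!: exI[of _ "sqrt t"])
  then obtain v' where "0 < v'" "Complex u v' \<in> D" "v' < v"
    using cInf_lessD[of "{v. v > 0 \<and> Complex u v \<in> D}" v] assms[unfolded v_t_eq] by auto
  then show ?thesis
    using mem_D_mono[of v' v u] by auto
qed

text \<open>Membership is monotone in the absolute height, and the infimum belongs to the set
  because \<open>D\<close> is closed.\<close>

lemma mem_D_iff: "z \<in> D \<longleftrightarrow> v_t \<mu> t (Re z) \<le> \<bar>Im z\<bar>"
proof
  assume z: "z \<in> D"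
  show "v_t \<mu> t (Re z) \<le> \<bar>Im z\<bar>"
  proof (rule field_le_epsilon)
    \<comment> \<open>The infimum runs over positive heights only, while \<open>Im z\<close> may be
      zero; hence the slack \<open>e\<close>.\<close>
    fix e :: real assume "e > 0"
    then show "v_t \<mu> t (Re z) \<le> \<bar>Im z\<bar> + e"
      using z mem_D_mono[of "Im z" "\<bar>Im z\<bar> + e" "Re z"] by (intro v_t_le) auto
  qed
next
  assume le: "v_t \<mu> t (Re z) \<le> \<bar>Im z\<bar>"
  have "Complex (Re z) (\<bar>Im z\<bar> + inverse (real (Suc n))) \<in> D" for n
  proof (rule mem_D_above)
    have "0 < inverse (real (Suc n))"
      by simp
    with le show "v_t \<mu> t (Re z) < \<bar>Im z\<bar> + inverse (real (Suc n))"
      by linarith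
  qed
  moreover have "(\<lambda>n. Complex (Re z) (\<bar>Im z\<bar> + inverse (real (Suc n))))
      \<longlonglongrightarrow> Complex (Re z) (\<bar>Im z\<bar> + 0)"
    by (intro tendsto_Complex tendsto_add tendsto_const LIMSEQ_inverse_real_of_nat)
  ultimately have "Complex (Re z) (\<bar>Im z\<bar> + 0) \<in> D"
    by (rule closed_sequentially[OF closed_D])
  then show "z \<in> D"
    using mem_D_mono[of "\<bar>Im z\<bar>" "Im z" "Re z"] by simp
qed

lemma Compl_Lambda_t: "- Lambda_t \<mu> t = D"
  by (auto simp: Lambda_t_def mem_D_iff)

text \<open>A point of the closed upper part is the limit of points lifted slightly above it, which
  lie in \<open>Gamma_t\<close>; the other inclusion holds because the right-hand side is
  closed.\<close>

lemma closure_Gamma_t: "closure (Gamma_t \<mu> t) = D \<inter> {z. Im z \<ge> 0}"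
proof
  have "Gamma_t \<mu> t \<subseteq> D \<inter> {z. Im z \<ge> 0}"
    using v_t_nonneg by (auto simp: Gamma_t_def mem_D_iff) (meson le_less_trans less_imp_le v_t_nonneg)+
  then show "closure (Gamma_t \<mu> t) \<subseteq> D \<inter> {z. Im z \<ge> 0}"
    by (intro closure_minimal closed_Int closed_D closed_halfspace_Im_ge)
next
  show "D \<inter> {z. Im z \<ge> 0} \<subseteq> closure (Gamma_t \<mu> t)"
  proof
    fix z assume z: "z \<in> D \<inter> {z. Im z \<ge> 0}"
    have "Complex (Re z) (Im z + inverse (real (Suc n))) \<in> Gamma_t \<mu> t" for n
      using z by (auto simp: Gamma_t_def mem_D_iff intro: le_less_trans)
    moreover have "(\<lambda>n. Complex (Re z) (Im z + inverse (real (Suc n))))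
        \<longlonglongrightarrow> Complex (Re z) (Im z + 0)"
      by (intro tendsto_Complex tendsto_add tendsto_const LIMSEQ_inverse_real_of_nat)
    ultimately show "z \<in> closure (Gamma_t \<mu> t)"
      unfolding closure_sequential by (auto intro!: exI)
  qed
qed

section \<open>Integrability and norm bounds on the sublevel set\<close>

text \<open>Finite energy excludes an atom at \<open>z\<close>. This is what permits division by
  \<open>z - x\<close> under the integral when \<open>z\<close> is real.\<close>

lemma AE_neq_of_mem_D:
  assumes "z \<in> D"
  shows "AE x in \<mu>. z \<noteq> of_real x"
proof -
  have "energy z \<noteq> \<infinity>"
    using assms by (auto simp: D_def top_unique)
  then have "AE x in \<mu>. inverse (ennreal ((cmod (z - of_real x))\<^sup>2)) \<noteq> \<infinity>"
    unfolding energy_def by (intro nn_integral_PInf_AE) auto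
  then show ?thesis
    by eventually_elim auto
qed

lemma energy_eq_nn_integral:
  assumes "z \<in> D"
  shows "energy z = (\<integral>\<^sup>+x. ennreal (1 / (cmod (z - of_real x))\<^sup>2) \<partial>\<mu>)"
  unfolding energy_def
proof (rule nn_integral_cong_AE)
  show "AE x in \<mu>. inverse (ennreal ((cmod (z - of_real x))\<^sup>2)) = ennreal (1 / (cmod (z - of_real x))\<^sup>2)"
    using AE_neq_of_mem_D[OF assms]
    by eventually_elim (subst inverse_ennreal, auto simp: divide_inverse)
qed

lemma
  assumes "z \<in> D"
  shows integrable_norm_square: "integrable \<mu> (\<lambda>x. 1 / (cmod (z - of_real x))\<^sup>2)"
    and integral_norm_square_le: "(\<integral>x. 1 / (cmod (z - of_real x))\<^sup>2 \<partial>\<mu>) \<le> 1 / t"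
proof -
  have le: "(\<integral>\<^sup>+x. ennreal (1 / (cmod (z - of_real x))\<^sup>2) \<partial>\<mu>) \<le> ennreal (1 / t)"
    using assms energy_eq_nn_integral[OF assms] by (simp add: D_def)
  show int: "integrable \<mu> (\<lambda>x. 1 / (cmod (z - of_real x))\<^sup>2)"
    by (rule integrableI_bounded) (use le in \<open>auto intro: le_less_trans simp: norm_divide\<close>)
  show "(\<integral>x. 1 / (cmod (z - of_real x))\<^sup>2 \<partial>\<mu>) \<le> 1 / t"
    using le t_pos by (subst (asm) nn_integral_eq_integral[OF int]) (auto simp: ennreal_le_iff)
qed

text \<open>This pointwise arithmetic-geometric mean bound does the work of Cauchy--Schwarz: both
  energies are at most \<open>1 / t\<close>, so their mean obeys the same bound.\<close>

lemma norm_pair_le: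
  "cmod (1 / ((z - of_real x) * (w - of_real x)))
    \<le> (1 / (cmod (z - of_real x))\<^sup>2 + 1 / (cmod (w - of_real x))\<^sup>2) / 2"
  using sum_squares_bound[of "1 / cmod (z - of_real x)" "1 / cmod (w - of_real x)"]
  by (simp add: norm_divide norm_mult power_divide)

lemma
  assumes "z \<in> D" "w \<in> D"
  shows integrable_norm_pair_bound:
      "integrable \<mu> (\<lambda>x. (1 / (cmod (z - of_real x))\<^sup>2 + 1 / (cmod (w - of_real x))\<^sup>2) / 2)"
    and integral_norm_pair_bound_le:
      "(\<integral>x. (1 / (cmod (z - of_real x))\<^sup>2 + 1 / (cmod (w - of_real x))\<^sup>2) / 2 \<partial>\<mu>) \<le> 1 / t"
proof -
  note int = integrable_norm_square[OF assms(1)] integrable_norm_square[OF assms(2)]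
  show "integrable \<mu> (\<lambda>x. (1 / (cmod (z - of_real x))\<^sup>2 + 1 / (cmod (w - of_real x))\<^sup>2) / 2)"
    using int by simp
  show "(\<integral>x. (1 / (cmod (z - of_real x))\<^sup>2 + 1 / (cmod (w - of_real x))\<^sup>2) / 2 \<partial>\<mu>) \<le> 1 / t"
    using integral_norm_square_le[OF assms(1)] integral_norm_square_le[OF assms(2)]
    by (simp add: Bochner_Integration.integral_add[OF int])
qed

lemma integrable_pair:
  assumes "z \<in> D" "w \<in> D"
  shows "integrable \<mu> (\<lambda>x. 1 / ((z - of_real x) * (w - of_real x)))"
  by (rule Bochner_Integration.integrable_bound[OF integrable_norm_pair_bound[OF assms]])
     (measurable, intro AE_I2 order_trans[OF norm_pair_le], simp)

lemma norm_Q_le: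
  assumes "z \<in> D" "w \<in> D"
  shows "cmod (Q z w) \<le> 1 / t"
  unfolding Q_def
  by (rule order_trans[OF Bochner_Integration.integral_norm_bound_integral integral_norm_pair_bound_le[OF assms]])
     (use integrable_pair integrable_norm_pair_bound norm_pair_le assms in auto)

lemma norm_single_le: "cmod (1 / (z - of_real x)) \<le> (1 + 1 / (cmod (z - of_real x))\<^sup>2) / 2"
  using sum_squares_bound[of 1 "1 / cmod (z - of_real x)"]
  by (simp add: norm_divide power_divide)

lemma integrable_single:
  assumes "z \<in> D"
  shows "integrable \<mu> (\<lambda>x. 1 / (z - of_real x))"
proof (rule Bochner_Integration.integrable_bound)
  show "integrable \<mu> (\<lambda>x. (1 + 1 / (cmod (z - of_real x))\<^sup>2) / 2)"
    using integrable_norm_square[OF assms] by simp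
  show "AE x in \<mu>. norm (1 / (z - of_real x)) \<le> norm ((1 + 1 / (cmod (z - of_real x))\<^sup>2) / 2)"
    by (intro AE_I2 order_trans[OF norm_single_le]) simp
qed measurable

lemma norm_cauchy_transform_le:
  assumes "z \<in> D"
  shows "cmod (cauchy_transform \<mu> z) \<le> (1 + 1 / t) / 2"
proof -
  have "cmod (cauchy_transform \<mu> z) \<le> (\<integral>x. (1 + 1 / (cmod (z - of_real x))\<^sup>2) / 2 \<partial>\<mu>)"
    unfolding cauchy_transform_def
    using integrable_norm_square[OF assms] integrable_single[OF assms] norm_single_le
    by (intro Bochner_Integration.integral_norm_bound_integral) auto
  also have "\<dots> \<le> (1 + 1 / t) / 2"
    using integral_norm_square_le[OF assms] integrable_norm_square[OF assms]
    by (simp add: prob_space)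
  finally show ?thesis .
qed

text \<open>The uniform bound on the displacement gives properness of \<open>H_mt\<close>,
  surjectivity of \<open>f_t\<close> and control of its inverse near infinity.\<close>

lemma norm_H_mt_diff_id_le:
  assumes "z \<in> D"
  shows "cmod (H_mt \<mu> t z - z) \<le> (t + 1) / 2"
proof -
  have "cmod (H_mt \<mu> t z - z) = t * cmod (cauchy_transform \<mu> z)"
    using t_pos by (simp add: H_mt_def norm_mult)
  also have "\<dots> \<le> t * ((1 + 1 / t) / 2)"
    using t_pos norm_cauchy_transform_le[OF assms] by (intro mult_left_mono) auto
  also have "\<dots> = (t + 1) / 2"
    using t_pos by (simp add: field_simps)
  finally show ?thesis .
qed

section \<open>The difference formula, conjugation symmetry and injectivity\<close>

text \<open>This is the resolvent identity integrated over \<open>x\<close>; it holds almost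
  everywhere because neither \<open>z\<close> nor \<open>w\<close> carries mass.\<close>

lemma H_mt_diff:
  assumes "z \<in> D" "w \<in> D"
  shows "H_mt \<mu> t z - H_mt \<mu> t w = (z - w) * (1 + of_real t * Q z w)"
proof -
  have "cauchy_transform \<mu> z - cauchy_transform \<mu> w
      = (\<integral>x. 1 / (z - of_real x) - 1 / (w - of_real x) \<partial>\<mu>)"
    unfolding cauchy_transform_def using assms integrable_single
    by (intro Bochner_Integration.integral_diff[symmetric]) auto
  also have "\<dots> = (\<integral>x. (w - z) * (1 / ((z - of_real x) * (w - of_real x))) \<partial>\<mu>)"
  proof (rule integral_cong_AE)
    show "AE x in \<mu>. 1 / (z - of_real x) - 1 / (w - of_real x)
        = (w - z) * (1 / ((z - of_real x) * (w - of_real x)))"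
      using AE_neq_of_mem_D[OF assms(1)] AE_neq_of_mem_D[OF assms(2)]
      by eventually_elim (simp add: divide_simps)
  qed measurable
  also have "\<dots> = (w - z) * Q z w"
    unfolding Q_def by (rule integral_mult_right_zero)
  finally show ?thesis
    by (simp add: H_mt_def algebra_simps)
      (metis (no_types) diff_add_cancel distrib_left mult.left_commute right_diff_distrib)
qed

lemma H_mt_lipschitz:
  assumes "z \<in> D" "w \<in> D"
  shows "cmod (H_mt \<mu> t z - H_mt \<mu> t w) \<le> 2 * cmod (z - w)"
proof -
  have "cmod (1 + of_real t * Q z w) \<le> 1 + t * cmod (Q z w)"
    using norm_triangle_ineq[of 1 "of_real t * Q z w"] t_pos by (simp add: norm_mult)
  also have "\<dots> \<le> 1 + t * (1 / t)"
    using norm_Q_le[OF assms] t_pos by (intro add_left_mono mult_left_mono) auto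
  also have "\<dots> = 2"
    using t_pos by simp
  finally show ?thesis
    unfolding H_mt_diff[OF assms] norm_mult
    by (subst mult.commute) (rule mult_right_mono, auto)
qed

lemma continuous_on_H_mt: "continuous_on D (H_mt \<mu> t)"
proof (rule lipschitz_on_continuous_on)
  show "2-lipschitz_on D (H_mt \<mu> t)"
    by (rule lipschitz_onI) (auto simp: dist_norm H_mt_lipschitz)
qed

lemma H_mt_cnj: "H_mt \<mu> t (cnj z) = cnj (H_mt \<mu> t z)"
proof -
  have "cauchy_transform \<mu> (cnj z) = (\<integral>x. cnj (1 / (z - of_real x)) \<partial>\<mu>)"
    unfolding cauchy_transform_def by simp
  also have "\<dots> = cnj (cauchy_transform \<mu> z)"
    unfolding cauchy_transform_def by (rule Bochner_Integration.integral_cnj)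
  finally show ?thesis
    by (simp add: H_mt_def)
qed

lemma cnj_mem_D: "cnj z \<in> D \<longleftrightarrow> z \<in> D"
  by (simp add: mem_D_iff)

text \<open>The imaginary part of \<open>1 / (z - x)\<close> is \<open>- Im z\<close> divided by the
  squared distance, so the imaginary part is stretched by one plus \<open>t\<close> times the
  energy.\<close>

lemma Im_H_mt:
  assumes "z \<in> D"
  shows "Im (H_mt \<mu> t z) = Im z * (1 + t * (\<integral>x. 1 / (cmod (z - of_real x))\<^sup>2 \<partial>\<mu>))"
proof -
  have "Im (cauchy_transform \<mu> z) = (\<integral>x. Im (1 / (z - of_real x)) \<partial>\<mu>)"
    unfolding cauchy_transform_def using integrable_single[OF assms] by (rule integral_Im[symmetric])
  also have "\<dots> = (\<integral>x. - Im z * (1 / (cmod (z - of_real x))\<^sup>2) \<partial>\<mu>)"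
    by (intro Bochner_Integration.integral_cong) (auto simp: Im_divide cmod_power2)
  also have "\<dots> = - Im z * (\<integral>x. 1 / (cmod (z - of_real x))\<^sup>2 \<partial>\<mu>)"
    by (rule integral_mult_right_zero)
  finally show ?thesis
    by (simp add: H_mt_def algebra_simps)
qed

text \<open>Equality in Cauchy--Schwarz would force an affine relation on \<open>\<mu>\<close>-almost every \<open>x\<close>.\<close>

lemma norm_Q_less:
  assumes z: "z \<in> D" "Im z \<ge> 0" and w: "w \<in> D" "Im w \<ge> 0"
    and neq: "z \<noteq> w \<or> Im z > 0"
  shows "t * cmod (Q z w) < 1"
proof (rule ccontr)
  assume "\<not> t * cmod (Q z w) < 1"
  then have ge: "1 / t \<le> cmod (Q z w)"
    using t_pos by (simp add: field_simps)
  have Qpos: "cmod (Q z w) > 0"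
    using ge t_pos by (meson less_le_trans zero_less_divide_1_iff)
  \<comment> \<open>A unimodular factor that rotates \<open>Q z w\<close> onto the positive real
    axis.\<close>
  define \<omega> where "\<omega> = cnj (Q z w) / of_real (cmod (Q z w))"
  have norm_\<omega>: "cmod \<omega> = 1"
    using Qpos by (simp add: \<omega>_def norm_divide)
  have \<omega>_Q: "\<omega> * Q z w = of_real (cmod (Q z w))"
    using Qpos complex_norm_square[of "Q z w"]
    by (simp add: \<omega>_def power2_eq_square mult.commute[of "cnj _"] divide_eq_eq)
  \<comment> \<open>The integral of this square is the sum of the two energies minus
    \<open>2 * cmod (Q z w)\<close>, the defect in the inequality. It must vanish under the contrary
    assumption.\<close>
  define g where "g x = (cmod (1 / (z - of_real x) - cnj (\<omega> / (w - of_real x))))\<^sup>2" for x :: real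
  have g_eq: "g x = 1 / (cmod (z - of_real x))\<^sup>2 + 1 / (cmod (w - of_real x))\<^sup>2
      - 2 * Re (\<omega> * (1 / ((z - of_real x) * (w - of_real x))))" for x
  proof -
    have *: "(cmod (a - cnj b))\<^sup>2 = (cmod a)\<^sup>2 + (cmod b)\<^sup>2 - 2 * Re (a * b)" for a b
      unfolding cmod_power2 by (simp add: power2_eq_square algebra_simps)
    show ?thesis
      unfolding g_def * by (simp add: norm_divide norm_\<omega> power_divide)
  qed
  note int = integrable_norm_square[OF z(1)] integrable_norm_square[OF w(1)]
    integrable_mult_right[OF integrable_pair[OF z(1) w(1)], of \<omega>]
  have int_g: "integrable \<mu> g"
    unfolding g_eq by (intro Bochner_Integration.integrable_diff
        Bochner_Integration.integrable_add integrable_mult_right[of 2] integrable_Re int)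
  have "(\<integral>x. g x \<partial>\<mu>) = (\<integral>x. 1 / (cmod (z - of_real x))\<^sup>2 \<partial>\<mu>)
      + (\<integral>x. 1 / (cmod (w - of_real x))\<^sup>2 \<partial>\<mu>)
      - 2 * Re (\<omega> * Q z w)"
  proof -
    have "(\<integral>x. Re (\<omega> * (1 / ((z - of_real x) * (w - of_real x)))) \<partial>\<mu>) = Re (\<omega> * Q z w)"
      unfolding Q_def integral_mult_right_zero[symmetric] by (rule integral_Re[OF int(3)])
    moreover have "(\<integral>x. g x \<partial>\<mu>) = (\<integral>x. 1 / (cmod (z - of_real x))\<^sup>2 \<partial>\<mu>)
        + (\<integral>x. 1 / (cmod (w - of_real x))\<^sup>2 \<partial>\<mu>)
        - 2 * (\<integral>x. Re (\<omega> * (1 / ((z - of_real x) * (w - of_real x)))) \<partial>\<mu>)"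
      unfolding g_eq Bochner_Integration.integral_diff[OF
          Bochner_Integration.integrable_add[OF int(1,2)] integrable_mult_right[OF integrable_Re[OF int(3)]]]
        Bochner_Integration.integral_add[OF int(1,2)] integral_mult_right_zero ..
    ultimately show ?thesis
      by simp
  qed
  also have "\<dots> \<le> 1 / t + 1 / t - 2 * (1 / t)"
    using ge integral_norm_square_le[OF z(1)] integral_norm_square_le[OF w(1)]
    unfolding \<omega>_Q by (intro diff_mono add_mono) auto
  finally have "(\<integral>x. g x \<partial>\<mu>) = 0"
    using Bochner_Integration.integral_nonneg[of \<mu> g] by (intro antisym) (simp_all add: g_def)
  then have "AE x in \<mu>. g x = 0"
    by (subst (asm) integral_nonneg_eq_0_iff_AE[OF int_g]) (auto simp: g_def)
  then have rel: "AE x in \<mu>. (cnj \<omega> - 1) * of_real x = cnj \<omega> * z - cnj w"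
    using AE_neq_of_mem_D[OF z(1)] AE_neq_of_mem_D[OF w(1)]
  proof eventually_elim
    case (elim x)
    have "cnj w - of_real x \<noteq> 0"
      using elim(3) by (metis complex_cnj_cnj complex_cnj_complex_of_real right_minus_eq)
    moreover have "1 / (z - of_real x) = cnj \<omega> / (cnj w - of_real x)"
      using elim(1) by (simp add: g_def)
    ultimately have "cnj w - of_real x = cnj \<omega> * (z - of_real x)"
      using elim(2) by (simp add: field_simps)
    then show ?case
      by (simp add: algebra_simps)
  qed
  \<comment> \<open>If the phase is 1, the relation says \<open>z = cnj w\<close>, which in the
    closed upper half-plane makes \<open>z\<close> and \<open>w\<close> equal and real, against
    \<open>neq\<close>. Otherwise the relation determines \<open>x\<close>, and the measure is a
    point mass.\<close>
  show False
  proof (cases "cnj \<omega> = 1")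
    case True
    with rel have "AE x in \<mu>. z = cnj w"
      by simp
    then have "z = cnj w"
      by simp
    with z w neq show False
      by (auto simp: complex_eq_iff)
  next
    case False
    define c where "c = Re ((cnj \<omega> * z - cnj w) / (cnj \<omega> - 1))"
    from rel have "AE x in \<mu>. x = c"
    proof eventually_elim
      case (elim x)
      then have "of_real x = (cnj \<omega> * z - cnj w) / (cnj \<omega> - 1)"
        using False by (simp add: field_simps)
      then show ?case
        unfolding c_def by (metis Re_complex_of_real)
    qed
    then have "\<mu> = return \<mu> c"
      by (rule AE_eq_constD)
    also have "\<dots> = return borel c"
      by (rule return_cong[OF sets_borel])
    finally show False
      using not_dirac by blast
  qed
qed

lemma inj_on_H_mt: "inj_on (H_mt \<mu> t) (D \<inter> {z. Im z \<ge> 0})"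
proof (rule inj_onI)
  fix z w assume z: "z \<in> D \<inter> {z. Im z \<ge> 0}" and w: "w \<in> D \<inter> {z. Im z \<ge> 0}"
    and eq: "H_mt \<mu> t z = H_mt \<mu> t w"
  show "z = w"
  proof (rule ccontr)
    assume "z \<noteq> w"
    then have "cmod (of_real t * Q z w) < 1"
      using norm_Q_less[of z w] z w t_pos by (simp add: norm_mult)
    then have "1 + of_real t * Q z w \<noteq> 0"
      by (metis add_eq_0_iff less_irrefl norm_minus_cancel norm_one)
    then show False
      using H_mt_diff[of z w] z w eq \<open>z \<noteq> w\<close> by simp
  qed
qed

section \<open>The graph of the height function and the difference quotient of
  \<open>f_t\<close>\<close>

lemma cmod_Complex_diff: "(cmod (Complex u v - of_real x))\<^sup>2 = (u - x)\<^sup>2 + v\<^sup>2"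
  by (simp add: cmod_power2)

text \<open>One inequality is membership of the graph point in \<open>D\<close>. For the other,
  points just below the graph lie outside \<open>D\<close>, and the height tends to
  \<open>v_t\<close> from below.\<close>

lemma kernel_at_v_t:
  assumes "v_t \<mu> t u > 0"
  shows "(\<integral>x. 1 / ((u - x)\<^sup>2 + (v_t \<mu> t u)\<^sup>2) \<partial>\<mu>) = 1 / t"
proof (rule antisym)
  define v where "v = v_t \<mu> t u"
  define F where "F = (\<integral>x. 1 / ((u - x)\<^sup>2 + v\<^sup>2) \<partial>\<mu>)"
  have v: "v > 0"
    using assms by (simp add: v_def)
  show "(\<integral>x. 1 / ((u - x)\<^sup>2 + (v_t \<mu> t u)\<^sup>2) \<partial>\<mu>) \<le> 1 / t"
    using assms by (subst mem_D_iff_kernel[symmetric]) (auto simp: mem_D_iff)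
  \<comment> \<open>Lowering the height from \<open>v\<close> to \<open>v'\<close> enlarges the
    kernel by at most the factor \<open>(v / v')^2\<close>, which tends to 1; no limit under the
    integral is required.\<close>
  have le: "v'\<^sup>2 / t \<le> v\<^sup>2 * F" if v': "0 < v'" "v' < v" for v'
  proof -
    have "\<not> Complex u v' \<in> D"
      using v' by (simp add: mem_D_iff v_def)
    then have "1 / t \<le> (\<integral>x. 1 / ((u - x)\<^sup>2 + v'\<^sup>2) \<partial>\<mu>)"
      using v' by (simp add: mem_D_iff_kernel)
    also have "\<dots> \<le> (\<integral>x. (v / v')\<^sup>2 * (1 / ((u - x)\<^sup>2 + v\<^sup>2)) \<partial>\<mu>)"
    proof (rule integral_mono)
      fix x
      have "v'\<^sup>2 * (u - x)\<^sup>2 \<le> v\<^sup>2 * (u - x)\<^sup>2"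
        using v' by (intro mult_right_mono power_mono) auto
      moreover have "(u - x)\<^sup>2 + v'\<^sup>2 > 0" "(u - x)\<^sup>2 + v\<^sup>2 > 0"
        using v v' by (auto intro: add_nonneg_pos)
      ultimately show "1 / ((u - x)\<^sup>2 + v'\<^sup>2) \<le> (v / v')\<^sup>2 * (1 / ((u - x)\<^sup>2 + v\<^sup>2))"
        using v' by (simp add: power_divide divide_simps) (simp add: algebra_simps)
    qed (use v v' in \<open>auto intro: integrable_kernel integrable_mult_right simp del: times_divide_eq_right\<close>)
    also have "\<dots> = (v / v')\<^sup>2 * F"
      unfolding F_def by (rule integral_mult_right_zero)
    finally show ?thesis
      using v' t_pos by (simp add: field_simps)
  qed
  have "((\<lambda>v'. v'\<^sup>2 / t) \<longlongrightarrow> v\<^sup>2 / t) (at_left v)"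
    by (intro tendsto_intros) (use t_pos in auto)
  moreover have "\<forall>\<^sub>F v' in at_left v. v'\<^sup>2 / t \<le> v\<^sup>2 * F"
    using eventually_at_left_real[OF v] by eventually_elim (auto intro: le)
  ultimately have "v\<^sup>2 / t \<le> v\<^sup>2 * F"
    by (rule tendsto_upperbound) simp
  then show "1 / t \<le> (\<integral>x. 1 / ((u - x)\<^sup>2 + (v_t \<mu> t u)\<^sup>2) \<partial>\<mu>)"
    using v t_pos unfolding F_def v_def[symmetric] by (simp add: field_simps)
qed

abbreviation graph_point :: "real \<Rightarrow> complex" where
  "graph_point u \<equiv> Complex u (v_t \<mu> t u)"

lemma graph_point_mem_D: "graph_point u \<in> D"
  using v_t_nonneg by (simp add: mem_D_iff)

text \<open>Where the height is positive the energy equals \<open>1 / t\<close>, so the stretching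
  factor is 2; at height zero both sides have imaginary part zero.\<close>

lemma H_mt_graph_point: "H_mt \<mu> t (graph_point u) = Complex (f_t \<mu> t u) (2 * v_t \<mu> t u)"
proof -
  have "v_t \<mu> t u * (1 + t * (\<integral>x. 1 / ((u - x)\<^sup>2 + (v_t \<mu> t u)\<^sup>2) \<partial>\<mu>)) = 2 * v_t \<mu> t u"
    using kernel_at_v_t[of u] v_t_nonneg[of u] t_pos by (cases "v_t \<mu> t u = 0") auto
  then show ?thesis
    using Im_H_mt[OF graph_point_mem_D, of u] by (simp add: f_t_def complex_eq_iff cmod_Complex_diff)
qed

text \<open>Taking real and imaginary parts of \<open>H_mt_diff\<close> along the graph gives two linear equations for
  the increments of \<open>f_t\<close> and \<open>v_t\<close>; eliminating the latter leaves this exact difference quotient.\<close>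

lemma f_t_diff:
  fixes u u0
  defines "c \<equiv> of_real t * Q (graph_point u) (graph_point u0)"
  assumes "u \<noteq> u0"
  shows "cmod c < 1"
    and "f_t \<mu> t u - f_t \<mu> t u0 = (u - u0) * ((1 - (cmod c)\<^sup>2) / (1 - Re c))"
proof -
  show c: "cmod c < 1"
    unfolding c_def norm_mult using t_pos assms(2) v_t_nonneg
    by (simp add: norm_Q_less graph_point_mem_D)
  define dv where "dv = v_t \<mu> t u - v_t \<mu> t u0"
  have eq: "Complex (f_t \<mu> t u) (2 * v_t \<mu> t u) - Complex (f_t \<mu> t u0) (2 * v_t \<mu> t u0)
      = (graph_point u - graph_point u0) * (1 + c)"
    using H_mt_diff[OF graph_point_mem_D graph_point_mem_D, of u u0]
    unfolding H_mt_graph_point c_def by simp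
  have re: "f_t \<mu> t u - f_t \<mu> t u0 = (u - u0) * (1 + Re c) - dv * Im c"
    using arg_cong[OF eq, of Re] by (simp add: dv_def)
  have im: "dv * (1 - Re c) = (u - u0) * Im c"
    using arg_cong[OF eq, of Im] by (simp add: dv_def algebra_simps)
  have pos: "1 - Re c > 0"
    using c complex_Re_le_cmod[of c] by linarith
  have "(f_t \<mu> t u - f_t \<mu> t u0) * (1 - Re c)
      = (u - u0) * (1 + Re c) * (1 - Re c) - (dv * (1 - Re c)) * Im c"
    unfolding re by (simp add: algebra_simps)
  also have "\<dots> = (u - u0) * (1 - (cmod c)\<^sup>2)"
    unfolding im cmod_power2 by (simp add: algebra_simps power2_eq_square)
  finally show "f_t \<mu> t u - f_t \<mu> t u0 = (u - u0) * ((1 - (cmod c)\<^sup>2) / (1 - Re c))"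
    using pos by (simp add: field_simps)
qed

lemma strict_mono_f_t: "strict_mono (f_t \<mu> t)"
proof (rule strict_monoI)
  fix u0 u :: real assume "u0 < u"
  define c where "c = of_real t * Q (graph_point u) (graph_point u0)"
  have c: "cmod c < 1" "f_t \<mu> t u - f_t \<mu> t u0 = (u - u0) * ((1 - (cmod c)\<^sup>2) / (1 - Re c))"
    unfolding c_def using f_t_diff[of u u0] \<open>u0 < u\<close> by auto
  have "1 - Re c > 0"
    using c(1) complex_Re_le_cmod[of c] by linarith
  moreover have "(cmod c)\<^sup>2 < 1"
    using c(1) by (simp add: power_less_one_iff)
  ultimately have "f_t \<mu> t u - f_t \<mu> t u0 > 0"
    unfolding c(2) using \<open>u0 < u\<close> by simp
  then show "f_t \<mu> t u0 < f_t \<mu> t u"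
    by simp
qed

section \<open>Continuity of \<open>v_t\<close> and \<open>f_t\<close>\<close>

lemma isCont_kernel_integral:
  assumes "v \<noteq> 0"
  shows "isCont (\<lambda>u. \<integral>x. 1 / ((u - x)\<^sup>2 + v\<^sup>2) \<partial>\<mu>) u0"
  unfolding continuous_at_sequentially
proof (intro allI impI)
  fix X :: "nat \<Rightarrow> real" assume X: "X \<longlonglongrightarrow> u0"
  have pos: "(u - x)\<^sup>2 + v\<^sup>2 > 0" for u x
    using assms by (simp add: add_nonneg_pos)
  have "(\<lambda>n. \<integral>x. 1 / ((X n - x)\<^sup>2 + v\<^sup>2) \<partial>\<mu>) \<longlonglongrightarrow> (\<integral>x. 1 / ((u0 - x)\<^sup>2 + v\<^sup>2) \<partial>\<mu>)"
  proof (rule integral_dominated_convergence[where w = "\<lambda>_. 1 / v\<^sup>2"])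
    show "AE x in \<mu>. (\<lambda>n. 1 / ((X n - x)\<^sup>2 + v\<^sup>2)) \<longlonglongrightarrow> 1 / ((u0 - x)\<^sup>2 + v\<^sup>2)"
      using pos by (intro AE_I2 tendsto_intros X) (metis less_irrefl)
    show "AE x in \<mu>. norm (1 / ((X n - x)\<^sup>2 + v\<^sup>2)) \<le> 1 / v\<^sup>2" for n
      using assms pos by (intro AE_I2) (auto intro!: divide_left_mono mult_pos_pos)
  qed measurable
  then show "((\<lambda>u. \<integral>x. 1 / ((u - x)\<^sup>2 + v\<^sup>2) \<partial>\<mu>) \<circ> X)
      \<longlonglongrightarrow> (\<integral>x. 1 / ((u0 - x)\<^sup>2 + v\<^sup>2) \<partial>\<mu>)"
    by (simp add: o_def)
qed

text \<open>Lower semicontinuity comes from \<open>D\<close> being closed, upper semicontinuity from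
  continuity in \<open>u\<close> of the kernel integral at a fixed positive height.\<close>

lemma isCont_v_t: "isCont (v_t \<mu> t) u0"
  unfolding isCont_def
proof (rule order_tendstoI)
  fix a assume a: "a < v_t \<mu> t u0"
  show "\<forall>\<^sub>F u in at u0. a < v_t \<mu> t u"
  proof (cases "a < 0")
    case True
    then show ?thesis
      using v_t_nonneg by (intro always_eventually) (auto intro: less_le_trans)
  next
    case False
    have "((\<lambda>u. Complex u a) \<longlongrightarrow> Complex u0 a) (at u0)"
      by (intro tendsto_Complex tendsto_ident_at tendsto_const)
    moreover have "open (- D)" "Complex u0 a \<in> - D"
      using closed_D a False by (auto simp: mem_D_iff)
    ultimately have "\<forall>\<^sub>F u in at u0. Complex u a \<in> - D"
      by (rule topological_tendstoD)
    then show ?thesis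
      by eventually_elim (use False in \<open>auto simp: mem_D_iff\<close>)
  qed
next
  fix a assume a: "v_t \<mu> t u0 < a"
  obtain b where b: "v_t \<mu> t u0 < b" "b < a"
    using a dense by blast
  \<comment> \<open>The point at height \<open>m\<close> lies in \<open>D\<close>, so at the larger
    height \<open>b\<close> the kernel integral is strictly below \<open>1 / t\<close>. A strict
    inequality survives small changes of \<open>u\<close>.\<close>
  obtain m where m: "v_t \<mu> t u0 < m" "m < b"
    using b dense by blast
  have pos: "0 < m" "0 < b"
    using m v_t_nonneg[of u0] by auto
  have "(\<integral>x. 1 / ((u0 - x)\<^sup>2 + b\<^sup>2) \<partial>\<mu>) < (\<integral>x. 1 / ((u0 - x)\<^sup>2 + m\<^sup>2) \<partial>\<mu>)"
  proof (rule integral_less_AE_space)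
    show "AE x in \<mu>. 1 / ((u0 - x)\<^sup>2 + b\<^sup>2) < 1 / ((u0 - x)\<^sup>2 + m\<^sup>2)"
      using pos m by (intro AE_I2 divide_strict_left_mono mult_pos_pos)
        (auto intro: add_nonneg_pos power_strict_mono)
  qed (use pos integrable_kernel in \<open>auto simp: emeasure_space_1\<close>)
  also have "\<dots> \<le> 1 / t"
    using mem_D_above[OF m(1)] pos by (simp add: mem_D_iff_kernel)
  finally have "\<forall>\<^sub>F u in at u0. (\<integral>x. 1 / ((u - x)\<^sup>2 + b\<^sup>2) \<partial>\<mu>) < 1 / t"
    using isCont_kernel_integral[of b u0] pos unfolding isCont_def by (intro order_tendstoD) auto
  then show "\<forall>\<^sub>F u in at u0. v_t \<mu> t u < a"
  proof eventually_elim
    case (elim u)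
    then have "v_t \<mu> t u \<le> b"
      using pos by (intro v_t_le) (auto simp: mem_D_iff_kernel)
    then show ?case
      using b by simp
  qed
qed

lemma continuous_on_v_t: "continuous_on S (v_t \<mu> t)"
  using isCont_v_t by (simp add: continuous_at_imp_continuous_on)

lemma continuous_on_graph_point: "continuous_on S graph_point"
  by (intro continuous_on_Complex continuous_on_id continuous_on_v_t)

lemma continuous_on_f_t: "continuous_on UNIV (f_t \<mu> t)"
  unfolding f_t_def
  by (intro continuous_on_Re continuous_on_compose2[OF continuous_on_H_mt continuous_on_graph_point])
     (auto simp: graph_point_mem_D)

section \<open>Differentiability of \<open>f_t\<close> at points of positive height\<close>

text \<open>The difference contains one additional factor \<open>(w - z) / (w - x)\<close>, bounded
  by \<open>cmod (z - w) / Im w\<close>; what remains is estimated like \<open>Q\<close>. Hence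
  \<open>Q\<close> is continuous in its first argument as that point tends to \<open>w\<close>
  within \<open>D\<close>.\<close>

lemma Q_diff_le:
  assumes "z \<in> D" "w \<in> D" "Im w > 0"
  shows "cmod (Q z w - Q w w) \<le> cmod (z - w) / Im w * (1 / t)"
proof -
  have "Q z w - Q w w = (\<integral>x. 1 / ((z - of_real x) * (w - of_real x))
      - 1 / ((w - of_real x) * (w - of_real x)) \<partial>\<mu>)"
    unfolding Q_def using assms integrable_pair
    by (intro Bochner_Integration.integral_diff[symmetric]) auto
  also have "\<dots> = (\<integral>x. (w - z) / (w - of_real x) * (1 / ((z - of_real x) * (w - of_real x))) \<partial>\<mu>)"
  proof (rule integral_cong_AE)
    show "AE x in \<mu>. 1 / ((z - of_real x) * (w - of_real x)) - 1 / ((w - of_real x) * (w - of_real x))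
        = (w - z) / (w - of_real x) * (1 / ((z - of_real x) * (w - of_real x)))"
      using AE_neq_of_mem_D[OF assms(1)] AE_neq_of_mem_D[OF assms(2)]
      by eventually_elim (simp add: divide_simps)
  qed measurable
  also have "cmod \<dots> \<le> (\<integral>x. cmod (z - w) / Im w *
      ((1 / (cmod (z - of_real x))\<^sup>2 + 1 / (cmod (w - of_real x))\<^sup>2) / 2) \<partial>\<mu>)"
  proof (rule Bochner_Integration.integral_norm_bound_integral)
    let ?b = "\<lambda>x. cmod (z - w) / Im w *
      ((1 / (cmod (z - of_real x))\<^sup>2 + 1 / (cmod (w - of_real x))\<^sup>2) / 2)"
    show int: "integrable \<mu> ?b"
      by (intro integrable_mult_right integrable_norm_pair_bound assms)
    show le: "cmod ((w - z) / (w - of_real x) * (1 / ((z - of_real x) * (w - of_real x)))) \<le> ?b x" for x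
      unfolding norm_mult
    proof (intro mult_mono norm_pair_le)
      show "cmod ((w - z) / (w - of_real x)) \<le> cmod (z - w) / Im w"
        using cmod_ge_Im[of w x] assms(3)
        by (auto simp: norm_divide norm_minus_commute intro!: divide_left_mono mult_pos_pos)
    qed (use assms(3) in auto)
    show "integrable \<mu> (\<lambda>x. (w - z) / (w - of_real x) * (1 / ((z - of_real x) * (w - of_real x))))"
      by (rule Bochner_Integration.integrable_bound[OF int])
         (auto intro!: AE_I2 order_trans[OF le] simp del: times_divide_eq_right times_divide_eq_left)
  qed
  also have "\<dots> = cmod (z - w) / Im w *
      (\<integral>x. (1 / (cmod (z - of_real x))\<^sup>2 + 1 / (cmod (w - of_real x))\<^sup>2) / 2 \<partial>\<mu>)"
    by (rule integral_mult_right_zero)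
  also have "\<dots> \<le> cmod (z - w) / Im w * (1 / t)"
    using assms by (intro mult_left_mono integral_norm_pair_bound_le) auto
  finally show ?thesis .
qed

lemma f_t_has_derivative:
  assumes v: "v_t \<mu> t u0 > 0"
  shows "\<exists>d. (f_t \<mu> t has_real_derivative d) (at u0) \<and> 0 < d \<and> d < 2"
proof -
  define c where "c u = of_real t * Q (graph_point u) (graph_point u0)" for u
  define q where "q w = (1 - (cmod w)\<^sup>2) / (1 - Re w)" for w
  \<comment> \<open>On the diagonal the strict bound comes from the positive height, not from
    distinctness of the points.\<close>
  have c0: "cmod (c u0) < 1"
    unfolding c_def norm_mult using t_pos v by (simp add: norm_Q_less graph_point_mem_D)
  have pos: "1 - Re (c u0) > 0"
    using c0 complex_Re_le_cmod[of "c u0"] by linarith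
  have "((\<lambda>u. cmod (graph_point u - graph_point u0) / v_t \<mu> t u0 * (1 / t)) \<longlongrightarrow>
      cmod (graph_point u0 - graph_point u0) / v_t \<mu> t u0 * (1 / t)) (at u0)"
    using v t_pos isCont_v_t[of u0] unfolding isCont_def
    by (intro tendsto_intros tendsto_Complex) auto
  then have "((\<lambda>u. cmod (graph_point u - graph_point u0) / v_t \<mu> t u0 * (1 / t)) \<longlongrightarrow> 0) (at u0)"
    by simp
  then have "((\<lambda>u. Q (graph_point u) (graph_point u0) - Q (graph_point u0) (graph_point u0)) \<longlongrightarrow> 0) (at u0)"
    by (rule Lim_null_comparison[rotated])
       (intro always_eventually allI order_trans[OF Q_diff_le], auto simp: graph_point_mem_D v)
  then have "((\<lambda>u. Q (graph_point u) (graph_point u0)) \<longlongrightarrow> Q (graph_point u0) (graph_point u0)) (at u0)"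
    by (rule LIM_zero_cancel)
  then have "(c \<longlongrightarrow> c u0) (at u0)"
    unfolding c_def by (intro tendsto_intros)
  then have "((\<lambda>u. q (c u)) \<longlongrightarrow> q (c u0)) (at u0)"
    unfolding q_def using pos by (intro tendsto_intros) auto
  moreover have "\<forall>\<^sub>F u in at u0. q (c u) = (f_t \<mu> t u - f_t \<mu> t u0) / (u - u0)"
    using f_t_diff(2)[of _ u0]
    by (auto simp: eventually_at_filter q_def c_def intro!: always_eventually)
  ultimately have "((\<lambda>u. (f_t \<mu> t u - f_t \<mu> t u0) / (u - u0)) \<longlongrightarrow> q (c u0)) (at u0)"
    by (rule Lim_transform_eventually)
  then have "(f_t \<mu> t has_real_derivative q (c u0)) (at u0)"
    by (simp add: has_field_derivative_iff)
  moreover have "q (c u0) > 0"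
    using pos c0 by (simp add: q_def power_less_one_iff)
  moreover have "q (c u0) < 2"
  proof -
    \<comment> \<open>The bound \<open>q (c u0) < 2\<close> is equivalent to positivity of the
      squared modulus of \<open>1 - c u0\<close>.\<close>
    have "0 < (1 - Re (c u0))\<^sup>2 + (Im (c u0))\<^sup>2"
      using pos by (simp add: add_pos_nonneg)
    then have "1 - (cmod (c u0))\<^sup>2 < 2 * (1 - Re (c u0))"
      unfolding cmod_power2 by (simp add: power2_eq_square algebra_simps)
    then show ?thesis
      using pos by (simp add: q_def field_simps)
  qed
  ultimately show ?thesis
    by blast
qed

section \<open>Behaviour at infinity, the inverse of \<open>f_t\<close>, and
  \<open>phi_t\<close>\<close>

lemma kernel_integral_tendsto_0:
  assumes "v \<noteq> 0" and F: "F = at_top \<or> F = at_bot"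
  shows "((\<lambda>u. \<integral>x. 1 / ((u - x)\<^sup>2 + v\<^sup>2) \<partial>\<mu>) \<longlongrightarrow> 0) F"
proof -
  have lim: "((\<lambda>u. 1 / ((u - x)\<^sup>2 + v\<^sup>2)) \<longlongrightarrow> 0) at_top" for x
  proof -
    have "filterlim (\<lambda>u. - x + u) at_top at_top"
      by (rule filterlim_tendsto_add_at_top[OF tendsto_const filterlim_ident])
    then have "filterlim (\<lambda>u. v\<^sup>2 + (- x + u)\<^sup>2) at_top at_top"
      by (intro filterlim_tendsto_add_at_top[OF tendsto_const[of "v\<^sup>2"]] filterlim_pow_at_top) simp_all
    then have "((\<lambda>u. 1 / (v\<^sup>2 + (- x + u)\<^sup>2)) \<longlongrightarrow> 0) at_top"
      by (intro tendsto_divide_0[OF tendsto_const] filterlim_at_top_imp_at_infinity)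
    then show ?thesis
      by (simp add: add.commute)
  qed
  have bound: "norm (1 / (y\<^sup>2 + v\<^sup>2)) \<le> 1 / v\<^sup>2" for y
    using assms(1) by (auto intro!: divide_left_mono mult_pos_pos add_nonneg_pos)
  have "((\<lambda>u. \<integral>x. 1 / ((u - x)\<^sup>2 + v\<^sup>2) \<partial>\<mu>) \<longlongrightarrow> (\<integral>x. 0 \<partial>\<mu>)) at_top"
    by (rule integral_dominated_convergence_at_top[where w = "\<lambda>_. 1 / v\<^sup>2"])
       (use lim bound in \<open>auto intro!: always_eventually AE_I2\<close>)
  \<comment> \<open>The limit at minus infinity is reflected to plus infinity; the pointwise limit
    is then \<open>lim\<close> taken at \<open>- x\<close>.\<close>
  moreover have "((\<lambda>u. \<integral>x. 1 / ((- u - x)\<^sup>2 + v\<^sup>2) \<partial>\<mu>) \<longlongrightarrow> (\<integral>x. 0 \<partial>\<mu>)) at_top"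
  proof (rule integral_dominated_convergence_at_top[where w = "\<lambda>_. 1 / v\<^sup>2"])
    have "(- u - x)\<^sup>2 = (u - (- x))\<^sup>2" for u x :: real
      by (simp add: power2_eq_square algebra_simps)
    then show "AE x in \<mu>. ((\<lambda>u. 1 / ((- u - x)\<^sup>2 + v\<^sup>2)) \<longlongrightarrow> 0) at_top"
      by (intro AE_I2) (simp only: lim)
  qed (use bound in \<open>auto intro!: always_eventually AE_I2\<close>)
  ultimately show ?thesis
    using F by (auto simp: filterlim_at_bot_mirror)
qed

text \<open>At the fixed height \<open>e / 2\<close> the kernel integral eventually drops below
  \<open>1 / t\<close>, so the point at that height lies in \<open>D\<close>.\<close>

lemma v_t_tendsto_0:
  assumes "F = at_top \<or> F = at_bot"
  shows "(v_t \<mu> t \<longlongrightarrow> 0) F"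
proof (rule tendstoI)
  fix e :: real assume e: "e > 0"
  have "((\<lambda>u. \<integral>x. 1 / ((u - x)\<^sup>2 + (e / 2)\<^sup>2) \<partial>\<mu>) \<longlongrightarrow> 0) F"
    using e assms by (intro kernel_integral_tendsto_0) auto
  then have "\<forall>\<^sub>F u in F. (\<integral>x. 1 / ((u - x)\<^sup>2 + (e / 2)\<^sup>2) \<partial>\<mu>) < 1 / t"
    using t_pos by (intro order_tendstoD(2)) auto
  then show "\<forall>\<^sub>F u in F. dist (v_t \<mu> t u) 0 < e"
  proof eventually_elim
    case (elim u)
    then have "Complex u (e / 2) \<in> D"
      using e by (subst mem_D_iff_kernel) auto
    then have "v_t \<mu> t u \<le> e / 2"
      using e by (intro v_t_le) auto
    then show ?case
      using e v_t_nonneg[of u] by simp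
  qed
qed

lemma f_t_diff_id_le: "\<bar>f_t \<mu> t u - u\<bar> \<le> (t + 1) / 2"
  using abs_Re_le_cmod[of "H_mt \<mu> t (graph_point u) - graph_point u"]
    norm_H_mt_diff_id_le[OF graph_point_mem_D, of u]
  by (simp add: f_t_def)

lemma surj_f_t: "surj (f_t \<mu> t)"
  unfolding surj_def
proof
  fix y
  \<comment> \<open>Since \<open>f_t\<close> moves points by at most \<open>(t + 1) / 2\<close>,
    these two arguments bracket the value \<open>y\<close> for the intermediate value
    theorem.\<close>
  have "f_t \<mu> t (y - (t + 1) / 2) \<le> y" "y \<le> f_t \<mu> t (y + (t + 1) / 2)"
    using f_t_diff_id_le[of "y - (t + 1) / 2"] f_t_diff_id_le[of "y + (t + 1) / 2"] by linarith+
  then have "\<exists>u\<ge>y - (t + 1) / 2. u \<le> y + (t + 1) / 2 \<and> f_t \<mu> t u = y"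
    using t_pos by (intro IVT' continuous_on_subset[OF continuous_on_f_t]) (simp_all add: field_simps)
  then show "\<exists>u. y = f_t \<mu> t u"
    by blast
qed

lemma inj_f_t: "inj (f_t \<mu> t)"
  using strict_mono_f_t by (rule strict_mono_imp_inj_on)

lemma inv_f_t_f_t: "inv (f_t \<mu> t) (f_t \<mu> t u) = u"
  by (rule inv_f_f[OF inj_f_t])

lemma f_t_inv_f_t: "f_t \<mu> t (inv (f_t \<mu> t) y) = y"
  by (rule surj_f_inv_f[OF surj_f_t])

text \<open>A continuous injection of the line into itself is open by invariance of domain, and
  preimages under the inverse are images under \<open>f_t\<close>.\<close>

lemma continuous_on_inv_f_t: "continuous_on UNIV (inv (f_t \<mu> t))"
proof -
  have "open (inv (f_t \<mu> t) -` B)" if "open B" for B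
  proof -
    have "inv (f_t \<mu> t) -` B = f_t \<mu> t ` B"
      using inv_f_t_f_t f_t_inv_f_t by (auto simp: image_iff) metis
    moreover have "open (f_t \<mu> t ` B)"
      using that continuous_on_f_t inj_f_t
      by (intro invariance_of_domain) (auto intro: continuous_on_subset inj_on_subset)
    ultimately show ?thesis
      by simp
  qed
  then show ?thesis
    by (simp add: continuous_on_open_vimage)
qed

lemma continuous_on_phi_t: "continuous_on S (phi_t \<mu> t)"
  unfolding phi_t_def
  by (intro continuous_intros continuous_on_compose2[OF continuous_on_v_t[of UNIV]]
      continuous_on_subset[OF continuous_on_inv_f_t]) auto

lemma inv_f_t_diff_id_le: "\<bar>inv (f_t \<mu> t) y - y\<bar> \<le> (t + 1) / 2"
  using f_t_diff_id_le[of "inv (f_t \<mu> t) y"] by (simp add: f_t_inv_f_t abs_minus_commute)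

lemma filterlim_inv_f_t_at_top: "filterlim (inv (f_t \<mu> t)) at_top at_top"
  unfolding filterlim_at_top
proof
  fix Z
  show "\<forall>\<^sub>F y in at_top. Z \<le> inv (f_t \<mu> t) y"
    using eventually_ge_at_top[of "Z + (t + 1) / 2"]
  proof eventually_elim
    case (elim y)
    then show ?case
      using inv_f_t_diff_id_le[of y] by linarith
  qed
qed

lemma filterlim_inv_f_t_at_bot: "filterlim (inv (f_t \<mu> t)) at_bot at_bot"
  unfolding filterlim_at_bot
proof
  fix Z
  show "\<forall>\<^sub>F y in at_bot. inv (f_t \<mu> t) y \<le> Z"
    using eventually_le_at_bot[of "Z - (t + 1) / 2"]
  proof eventually_elim
    case (elim y)
    then show ?case
      using inv_f_t_diff_id_le[of y] by linarith
  qed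
qed

lemma phi_t_tendsto_0: "(phi_t \<mu> t \<longlongrightarrow> 0) at_top" "(phi_t \<mu> t \<longlongrightarrow> 0) at_bot"
proof -
  have "((\<lambda>y. 2 * v_t \<mu> t (inv (f_t \<mu> t) y)) \<longlongrightarrow> 2 * 0) at_top"
    using v_t_tendsto_0 by (intro tendsto_mult tendsto_const filterlim_compose[OF _ filterlim_inv_f_t_at_top]) auto
  then show "(phi_t \<mu> t \<longlongrightarrow> 0) at_top"
    by (simp add: phi_t_def[abs_def])
  have "((\<lambda>y. 2 * v_t \<mu> t (inv (f_t \<mu> t) y)) \<longlongrightarrow> 2 * 0) at_bot"
    using v_t_tendsto_0 by (intro tendsto_mult tendsto_const filterlim_compose[OF _ filterlim_inv_f_t_at_bot]) auto
  then show "(phi_t \<mu> t \<longlongrightarrow> 0) at_bot"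
    by (simp add: phi_t_def[abs_def])
qed

lemma phi_t_f_t: "phi_t \<mu> t (f_t \<mu> t u) = 2 * v_t \<mu> t u"
  by (simp add: phi_t_def inv_f_t_f_t)

lemma phi_t_nonneg: "0 \<le> phi_t \<mu> t u"
  using v_t_nonneg by (simp add: phi_t_def)

lemma phi_t_le: "phi_t \<mu> t u \<le> 2 * sqrt t"
  using v_t_le[OF _ sqrt_t_mem_D] t_pos by (simp add: phi_t_def)

lemma H_mt_graph:
  "H_mt \<mu> t ` {Complex u (v_t \<mu> t u) | u. True} = {Complex u (phi_t \<mu> t u) | u. True}"
proof -
  have "H_mt \<mu> t ` range graph_point = (\<lambda>y. Complex y (phi_t \<mu> t y)) ` range (f_t \<mu> t)"
    by (simp add: image_image H_mt_graph_point phi_t_f_t)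
  then show ?thesis
    by (simp add: surj_f_t full_SetCompr_eq)
qed

section \<open>Images of the regions above the graph\<close>

text \<open>Bounded displacement makes preimages of a convergent sequence bounded; a convergent
  subsequence has its limit in the closed domain, and continuity identifies the image.\<close>

lemma closed_H_mt_image: "closed (H_mt \<mu> t ` (D \<inter> {z. Im z \<ge> 0}))"
  unfolding closed_sequential_limits
proof (intro allI impI, elim conjE)
  let ?P = "D \<inter> {z. Im z \<ge> 0}"
  have P: "closed ?P"
    by (intro closed_Int closed_D closed_halfspace_Im_ge)
  fix W w assume W: "\<forall>n. W n \<in> H_mt \<mu> t ` ?P" and lim: "W \<longlonglongrightarrow> w"
  have "\<forall>n. \<exists>z. z \<in> ?P \<and> W n = H_mt \<mu> t z"
    using W by blast
  then obtain Z where Z: "\<And>n. Z n \<in> ?P" "\<And>n. W n = H_mt \<mu> t (Z n)"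
    unfolding choice_iff by blast
  obtain B where B: "\<And>n. cmod (W n) \<le> B"
    using convergent_imp_bounded[OF lim] by (auto simp: bounded_iff)
  have "cmod (Z n) \<le> B + (t + 1) / 2" for n
  proof -
    have "cmod (Z n - W n) \<le> (t + 1) / 2"
      using norm_H_mt_diff_id_le[of "Z n"] Z[of n] norm_minus_commute[of "Z n" "W n"] by auto
    then show ?thesis
      using norm_triangle_ineq2[of "Z n" "W n"] B[of n] by linarith
  qed
  then have "bounded (range Z)"
    by (auto simp: bounded_iff)
  then obtain z r where r: "strict_mono r" "(Z \<circ> r) \<longlonglongrightarrow> z"
    using bounded_imp_convergent_subsequence by blast
  have Zr: "(Z \<circ> r) n \<in> ?P" for n
    using Z(1)[of "r n"] by simp
  have z: "z \<in> ?P"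
    by (rule closed_sequentially[OF P Zr r(2)])
  have "(\<lambda>n. H_mt \<mu> t ((Z \<circ> r) n)) \<longlonglongrightarrow> H_mt \<mu> t z"
    by (rule continuous_on_tendsto_compose[OF continuous_on_H_mt r(2)]) (use z Zr in auto)
  moreover have "(\<lambda>n. H_mt \<mu> t ((Z \<circ> r) n)) \<longlonglongrightarrow> w"
    using LIMSEQ_subseq_LIMSEQ[OF lim r(1)] unfolding o_def Z(2) .
  ultimately have "w = H_mt \<mu> t z"
    using LIMSEQ_unique by blast
  then show "w \<in> H_mt \<mu> t ` ?P"
    using z by blast
qed

lemma Gamma_t_Un_graph:
  "D \<inter> {z. Im z \<ge> 0} = Gamma_t \<mu> t \<union> {Complex u (v_t \<mu> t u) | u. True}"
proof -
  have "z \<in> D \<inter> {z. Im z \<ge> 0} \<longleftrightarrow> v_t \<mu> t (Re z) \<le> Im z" for z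
    using v_t_nonneg[of "Re z"] by (auto simp: mem_D_iff)
  moreover have "z \<in> {Complex u (v_t \<mu> t u) | u. True} \<longleftrightarrow> v_t \<mu> t (Re z) = Im z" for z
    by (auto simp: complex_eq_iff)
  ultimately show ?thesis
    by (intro set_eqI) (auto simp: Gamma_t_def)
qed

lemma open_H_mt_Gamma_t: "open (H_mt \<mu> t ` Gamma_t \<mu> t)"
proof (rule invariance_of_domain)
  have sub: "Gamma_t \<mu> t \<subseteq> D \<inter> {z. Im z \<ge> 0}"
    using Gamma_t_Un_graph by blast
  show "continuous_on (Gamma_t \<mu> t) (H_mt \<mu> t)"
    using sub by (intro continuous_on_subset[OF continuous_on_H_mt]) auto
  show "inj_on (H_mt \<mu> t) (Gamma_t \<mu> t)"
    by (rule inj_on_subset[OF inj_on_H_mt sub])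
  show "open (Gamma_t \<mu> t)"
    unfolding Gamma_t_def
    by (intro open_Collect_less continuous_on_compose2[OF continuous_on_v_t[of UNIV]] continuous_intros) auto
qed

lemma H_mt_Gamma_t_disjoint_graph:
  "H_mt \<mu> t ` Gamma_t \<mu> t \<inter> {Complex u (phi_t \<mu> t u) | u. True} = {}"
proof -
  have "Gamma_t \<mu> t \<inter> {Complex u (v_t \<mu> t u) | u. True} = {}"
    by (auto simp: Gamma_t_def)
  then show ?thesis
    unfolding H_mt_graph[symmetric]
    by (subst inj_on_image_Int[OF inj_on_H_mt, symmetric]) (auto simp: Gamma_t_Un_graph)
qed

text \<open>Off the graph of \<open>phi_t\<close> the image of \<open>Gamma_t\<close> agrees with
  the closed image of its closure, so its trace on \<open>S\<close> is both open and closed in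
  \<open>S\<close>.\<close>

lemma connected_off_graph:
  assumes S: "connected S" "S \<inter> {Complex u (phi_t \<mu> t u) | u. True} = {}"
    and ne: "S \<inter> H_mt \<mu> t ` Gamma_t \<mu> t \<noteq> {}"
  shows "S \<subseteq> H_mt \<mu> t ` Gamma_t \<mu> t"
proof -
  have eq: "S \<inter> H_mt \<mu> t ` Gamma_t \<mu> t = S \<inter> H_mt \<mu> t ` (D \<inter> {z. Im z \<ge> 0})"
    unfolding Gamma_t_Un_graph image_Un H_mt_graph using S(2) by blast
  have "openin (top_of_set S) (S \<inter> H_mt \<mu> t ` Gamma_t \<mu> t)"
    using open_H_mt_Gamma_t by (simp add: openin_open_Int)
  moreover have "closedin (top_of_set S) (S \<inter> H_mt \<mu> t ` Gamma_t \<mu> t)"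
    unfolding eq using closed_H_mt_image by (simp add: closedin_closed_Int)
  ultimately have "S \<inter> H_mt \<mu> t ` Gamma_t \<mu> t = S"
    using S(1) ne unfolding connected_clopen by blast
  then show ?thesis
    by blast
qed

lemma Im_H_mt_ge:
  assumes "z \<in> D" "Im z \<ge> 0"
  shows "Im z \<le> Im (H_mt \<mu> t z)"
proof -
  have "0 \<le> (\<integral>x. 1 / (cmod (z - of_real x))\<^sup>2 \<partial>\<mu>)"
    by (rule Bochner_Integration.integral_nonneg) simp
  then show ?thesis
    unfolding Im_H_mt[OF assms(1)] using assms(2) t_pos by (simp add: algebra_simps)
qed

lemma H_mt_Gamma_t: "H_mt \<mu> t ` Gamma_t \<mu> t = {z. Im z > phi_t \<mu> t (Re z)}"
proof
  let ?U = "{z. Im z > phi_t \<mu> t (Re z)}" and ?L = "{z. Im z < phi_t \<mu> t (Re z)}"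
  have sub: "Gamma_t \<mu> t \<subseteq> D \<inter> {z. Im z \<ge> 0}"
    using Gamma_t_Un_graph by blast
  show "?U \<subseteq> H_mt \<mu> t ` Gamma_t \<mu> t"
  proof (rule connected_off_graph)
    show "connected ?U"
      by (rule connected_above_below_graph[OF continuous_on_phi_t])
    \<comment> \<open>This height exceeds the uniform bound \<open>2 * sqrt t\<close> on
      \<open>phi_t\<close>, and \<open>H_mt\<close> does not lower points of the closed upper part
      of \<open>D\<close>.\<close>
    define z where "z = Complex 0 (2 * sqrt t + 1)"
    have "v_t \<mu> t 0 \<le> sqrt t"
      using t_pos by (intro v_t_le sqrt_t_mem_D) auto
    then have z: "z \<in> Gamma_t \<mu> t"
      using t_pos by (simp add: z_def Gamma_t_def) (smt (verit) real_sqrt_gt_0_iff)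
    have "phi_t \<mu> t (Re (H_mt \<mu> t z)) < Im z"
      using phi_t_le[of "Re (H_mt \<mu> t z)"] by (simp add: z_def)
    also have "\<dots> \<le> Im (H_mt \<mu> t z)"
      using sub z by (intro Im_H_mt_ge) auto
    finally show "?U \<inter> H_mt \<mu> t ` Gamma_t \<mu> t \<noteq> {}"
      using z by blast
  qed auto
  have "?L \<inter> H_mt \<mu> t ` Gamma_t \<mu> t = {}"
  proof (rule ccontr)
    \<comment> \<open>A single common point would put the whole lower region, and with it a point of
      negative imaginary part, into the image, whose imaginary parts are nonnegative.\<close>
    assume "?L \<inter> H_mt \<mu> t ` Gamma_t \<mu> t \<noteq> {}"
    then have "?L \<subseteq> H_mt \<mu> t ` Gamma_t \<mu> t"
      by (intro connected_off_graph connected_above_below_graph[OF continuous_on_phi_t]) auto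
    moreover have "Complex 0 (-1) \<in> ?L"
      using phi_t_nonneg[of 0] by simp
    ultimately have "Complex 0 (-1) \<in> H_mt \<mu> t ` Gamma_t \<mu> t"
      by (rule subsetD)
    then obtain z where z: "z \<in> Gamma_t \<mu> t" "Complex 0 (-1) = H_mt \<mu> t z"
      by (rule imageE)
    have "0 \<le> Im (H_mt \<mu> t z)"
      using subsetD[OF sub z(1)] Im_H_mt_ge[of z] by auto
    then show False
      by (simp flip: z(2))
  qed
  moreover have "w \<in> ?U \<union> ?L \<union> {Complex u (phi_t \<mu> t u) | u. True}" for w
    by (auto simp: complex_eq_iff)
  ultimately show "H_mt \<mu> t ` Gamma_t \<mu> t \<subseteq> ?U"
    using H_mt_Gamma_t_disjoint_graph by blast
qed

lemma H_mt_closure_Gamma_t: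
  "H_mt \<mu> t ` (D \<inter> {z. Im z \<ge> 0}) = {z. Im z \<ge> phi_t \<mu> t (Re z)}"
proof -
  have "w \<in> {Complex u (phi_t \<mu> t u) | u. True} \<longleftrightarrow> phi_t \<mu> t (Re w) = Im w" for w
    by (auto simp: complex_eq_iff)
  then show ?thesis
    unfolding Gamma_t_Un_graph image_Un H_mt_graph H_mt_Gamma_t by (intro set_eqI) auto
qed

section \<open>Reflection to the lower half-plane and the domain \<open>Omega_t\<close>\<close>

text \<open>The set \<open>D\<close> is its upper part together with the conjugate of that part, and
  \<open>H_mt\<close> commutes with conjugation; so the image of \<open>D\<close> is the closed
  region above the graph of \<open>phi_t\<close> together with its mirror image.\<close>

lemma Omega_t_eq: "Omega_t \<mu> t = {z. \<bar>Im z\<bar> < phi_t \<mu> t (Re z)}"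
proof -
  let ?P = "D \<inter> {z. Im z \<ge> 0}"
  have D: "D = ?P \<union> cnj ` ?P"
  proof (intro set_eqI iffI)
    fix z assume "z \<in> D"
    then have "z \<in> ?P \<or> cnj z \<in> ?P"
      by (auto simp: cnj_mem_D)
    then show "z \<in> ?P \<union> cnj ` ?P"
      by (metis UnCI complex_cnj_cnj imageI)
  qed (auto simp: cnj_mem_D)
  have "H_mt \<mu> t ` D = H_mt \<mu> t ` ?P \<union> cnj ` H_mt \<mu> t ` ?P"
    by (subst D) (simp add: image_Un image_image H_mt_cnj)
  also have "\<dots> = {z. \<bar>Im z\<bar> \<ge> phi_t \<mu> t (Re z)}"
    unfolding H_mt_closure_Gamma_t
  proof (intro set_eqI iffI)
    fix w assume "w \<in> {z. \<bar>Im z\<bar> \<ge> phi_t \<mu> t (Re z)}"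
    then have "w \<in> {z. Im z \<ge> phi_t \<mu> t (Re z)} \<or> cnj w \<in> {z. Im z \<ge> phi_t \<mu> t (Re z)}"
      by auto
    then show "w \<in> {z. Im z \<ge> phi_t \<mu> t (Re z)} \<union> cnj ` {z. Im z \<ge> phi_t \<mu> t (Re z)}"
      by (metis UnCI complex_cnj_cnj imageI)
  qed (auto intro: order_trans)
  finally show ?thesis
    unfolding Omega_t_def Compl_Lambda_t by auto
qed

end

theorem theorem4p1:
  fixes \<mu> :: "real measure" and t :: real
  assumes "prob_space \<mu>"
    and "sets \<mu> = sets borel"
    and "\<forall>a. \<mu> \<noteq> return borel a"
    and "(\<integral>\<^sup>+ x. indicator {1..} x * ennreal (ln x) \<partial>\<mu>) < \<infinity>"
    and "t > 0"
  shows "continuous_on (closure (Gamma_t \<mu> t)) (H_mt \<mu> t)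
       \<and> inj_on (H_mt \<mu> t) (closure (Gamma_t \<mu> t))
       \<and> (\<forall>u0. v_t \<mu> t u0 > 0 \<longrightarrow>
            (\<exists>d. (f_t \<mu> t has_real_derivative d) (at u0) \<and> 0 < d \<and> d < 2))
       \<and> continuous_on UNIV (f_t \<mu> t)
       \<and> strict_mono (f_t \<mu> t)
       \<and> surj (f_t \<mu> t)
       \<and> (phi_t \<mu> t \<longlongrightarrow> 0) at_top
       \<and> (phi_t \<mu> t \<longlongrightarrow> 0) at_bot
       \<and> H_mt \<mu> t ` {Complex u (v_t \<mu> t u) | u. True} = {Complex u (phi_t \<mu> t u) | u. True}
       \<and> H_mt \<mu> t ` Gamma_t \<mu> t = {z. Im z > phi_t \<mu> t (Re z)}
       \<and> Omega_t \<mu> t = {z. \<bar>Im z\<bar> < phi_t \<mu> t (Re z)}"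
proof -
  interpret prob_space \<mu>
    by fact
  interpret nondegenerate_measure \<mu> t
    using assms(2,3,5) by unfold_locales auto
  have "continuous_on (closure (Gamma_t \<mu> t)) (H_mt \<mu> t)"
    unfolding closure_Gamma_t by (rule continuous_on_subset[OF continuous_on_H_mt]) auto
  moreover have "inj_on (H_mt \<mu> t) (closure (Gamma_t \<mu> t))"
    unfolding closure_Gamma_t by (rule inj_on_H_mt)
  ultimately show ?thesis
    using f_t_has_derivative continuous_on_f_t strict_mono_f_t surj_f_t phi_t_tendsto_0
      H_mt_graph H_mt_Gamma_t Omega_t_eq by blast
qed

end
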